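(* Let $n=3$ and $F=\mathbb{F}_2$, and let $K$ be the subgroup of $SL_3(\mathbb{F}_2[t])$ consisting of matrices congruent to the identity modulo $t$. Then $H_1(K)\cong \mathfrak{sl}_3(\mathbb{F}_2)$.
   Context: $H_1(K)=K/[K,K]$ is the integral first homology (abelianization) of $K$, and $\mathfrak{sl}_3(\mathbb{F}_2)$ is the additive group of trace-zero $3\times 3$ matrices over $\mathbb{F}_2$. *)

theory Defs
  imports "HOL-Analysis.Analysis" "HOL-Algebra.Algebra" "HOL-Library.Z2"
    "HOL-Computational_Algebra.Polynomial" "HOL-Number_Theory.Cong"
begin

definition special_linear_group :: "('a::comm_ring_1 ^ 'n ^ 'n) monoid" where
  "special_linear_group = \<lparr>carrier = {A. det A = 1}, mult = (**), one = mat 1\<rparr>"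

text \<open>The variable \<open>t\<close> of the polynomial ring \<open>F[t]\<close> is \<open>[:0, 1:]\<close>; two matrices are
  congruent modulo \<open>t\<close> if they are so entrywise.\<close>

definition principal_congruence_subgroup :: "('a::field poly ^ 'n ^ 'n) set" where
  "principal_congruence_subgroup =
     {A \<in> carrier special_linear_group. \<forall>i j. [A $ i $ j = mat 1 $ i $ j] (mod [:0, 1:])}"

definition principal_congruence_group :: "('a::field poly ^ 'n ^ 'n) monoid" where
  "principal_congruence_group =
     special_linear_group\<lparr>carrier := principal_congruence_subgroup\<rparr>"

definition abelianization :: "('a, 'b) monoid_scheme \<Rightarrow> 'a set monoid" where
  "abelianization G = G Mod (derived G (carrier G))"

definition sl_additive_group :: "('a::comm_ring_1 ^ 'n ^ 'n) monoid" where
  "sl_additive_group = \<lparr>carrier = {A. trace A = 0}, mult = (+), one = 0\<rparr>"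

end

theory Submission
  imports Defs
begin

text \<open>
  Sending \<open>A = 1 + tX + \<dots>\<close> to \<open>X mod t\<close> is a homomorphism from \<open>K\<close> onto the trace-zero matrices, so
  it suffices that every homomorphism \<open>q\<close> from \<open>K\<close> to an abelian group factors through it.
  Since \<open>SL\<^sub>3(F\<^sub>2[t])\<close> is generated by elementary matrices, \<open>K\<close> is generated by the transvections
  \<open>1 + t f u v\<^sup>T\<close> with \<open>u\<close>, \<open>v\<close> orthogonal constant vectors. If \<open>t\<close> divides \<open>f\<close>, such a
    transvection is
  a commutator in \<open>K\<close>, so only the values of \<open>q\<close> on the 21 transvections \<open>1
    + t u v\<^sup>T\<close>, indexed by the
  flags of the Fano plane, matter. They are additive in \<open>u\<close> for fixed \<open>v\<close> and vice versa; these are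
  14 relations with a single dependency between them, which leaves \<open>21 - 13 = 8\<close> dimensions, the
  dimension of the trace-zero matrices.
\<close>

text \<open>By default \<open>+\<close> and \<open>*\<close> on type \<open>bit\<close> are rewritten to bit operations, which defeats ring
  normalisation.\<close>

declare add_bit_eq_xor [simp del] mult_bit_eq_and [simp del]

lemma bit_add_self [simp]: "x + x = (0 :: bit)"
  by (cases x) simp_all

lemma bit_poly_numeral [simp]:
  "numeral (num.Bit0 n) = (0 :: bit poly)" "numeral (num.Bit1 n) = (1 :: bit poly)"
  by (simp_all add: numeral_poly one_pCons)

lemma bit_poly_minus: "p - q = p + (q :: bit poly)"
  by (simp add: poly_eq_iff)

lemma bit_poly_unit:
  assumes "p dvd (1 :: bit poly)" shows "p = 1"
proof -
  obtain c where c: "p = [:c:]" "c dvd 1"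
    using assms unfolding is_unit_poly_iff by blast
  then have "c = 1" by (cases c) simp_all
  then show ?thesis using c by simp
qed

section \<open>Transvections over a commutative ring\<close>

definition dot :: "'a::comm_ring_1 ^ 'n \<Rightarrow> 'a ^ 'n \<Rightarrow> 'a" where
  "dot a b = (\<Sum>i\<in>UNIV. a $ i * b $ i)"

definition outer :: "'a::comm_ring_1 ^ 'n \<Rightarrow> 'a ^ 'n \<Rightarrow> 'a ^ 'n ^ 'n" where
  "outer a b = (\<chi> i j. a $ i * b $ j)"

definition transvection :: "'a::comm_ring_1 ^ 'n \<Rightarrow> 'a ^ 'n \<Rightarrow> 'a ^ 'n ^ 'n" where
  "transvection a b = mat 1 + outer a b"

lemma matrix_add_rdistrib': "(A + B) ** C = A ** C + B ** C"
  by (simp add: matrix_matrix_mult_def vec_eq_iff sum.distrib distrib_right)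

lemma matrix_mult_outer: "A ** outer a b = outer (A *v a) b"
  by (simp add: outer_def matrix_matrix_mult_def matrix_vector_mult_def vec_eq_iff
      sum_distrib_right mult.assoc)

lemma outer_matrix_mult: "outer a b ** A = outer a (b v* A)"
  by (simp add: outer_def matrix_matrix_mult_def vector_matrix_mult_def vec_eq_iff
      sum_distrib_left mult_ac)

lemma dot_scale_left: "dot (c *s a) b = c * dot a b"
  by (simp add: dot_def sum_distrib_left mult.assoc)

lemma dot_scale_right: "dot a (c *s b) = c * dot a b"
  by (simp add: dot_def sum_distrib_left mult_ac)

lemma dot_commute: "dot a b = dot b a"
  by (simp add: dot_def mult.commute)

lemma outer_mult_vec: "outer a b *v c = dot b c *s a"
  by (simp add: outer_def matrix_vector_mult_def vec_eq_iff dot_def sum_distrib_left mult_ac)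

lemma outer_add_right: "outer a (b + b') = outer a b + outer a b'"
  and outer_add_left: "outer (a + a') b = outer a b + outer a' b"
  and outer_0_left [simp]: "outer 0 b = 0"
  and outer_0_right [simp]: "outer a 0 = 0"
  by (simp_all add: outer_def vec_eq_iff algebra_simps)

lemma outer_scale: "outer (c *s a) b = outer a (c *s b)"
  by (simp add: outer_def vec_eq_iff mult_ac)

lemma transvection_mult: "transvection a b ** A = A + outer a (b v* A)"
  by (simp add: transvection_def matrix_add_rdistrib' outer_matrix_mult)

lemma mult_transvection: "A ** transvection a b = A + outer (A *v a) b"
  by (simp add: transvection_def matrix_add_ldistrib matrix_mult_outer)

lemma transvection_mult_transvection: "transvection a b ** transvection c d
  = mat 1 + outer a b + outer c d + outer a (dot b c *s d)"
  by (simp add: mult_transvection)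
    (simp add: transvection_def matrix_vector_mult_add_rdistrib outer_add_left
     outer_mult_vec outer_scale)

lemma transvection_add_right: "dot b a = 0 \<Longrightarrow>
  transvection a b ** transvection a b' = transvection a (b + b')"
  by (subst transvection_mult_transvection) (simp add: transvection_def outer_add_right)

lemma transvection_add_left: "dot b a' = 0 \<Longrightarrow>
  transvection a b ** transvection a' b = transvection (a + a') b"
  by (subst transvection_mult_transvection) (simp add: transvection_def outer_add_left add.assoc)

lemma transvection_0_right [simp]: "transvection a 0 = mat 1"
  by (simp add: transvection_def)

lemma vec_mult_outer: "c v* outer a b = dot c a *s b"
  by (simp add: outer_def vector_matrix_mult_def vec_eq_iff dot_def sum_distrib_left mult_ac)

lemma transvection_conjugate:
  fixes A B :: "'a::comm_ring_1 ^ 'n ^ 'n"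
  shows "A ** B = mat 1 \<Longrightarrow> A ** transvection a b ** B = transvection (A *v a) (b v* B)"
  by (simp add: mult_transvection matrix_add_rdistrib' outer_matrix_mult)
    (simp add: transvection_def)

text \<open>The commutator relation, stated without inverses. Since \<open>dot d a = 0\<close>, only
  the order on the left produces a cross term, \<open>outer a (dot b c *s d)\<close>, and the extra
  transvection on the right supplies exactly this term.\<close>

lemma transvection_commutator:
  assumes "dot b a = 0" "dot d c = 0" "dot d a = 0"
  shows "transvection a b ** transvection c d
    = transvection a (dot b c *s d) ** (transvection c d ** transvection a b)"
proof -
  have "dot (dot b c *s d) c = 0" "dot (dot b c *s d) a = 0"
    using assms by (simp_all add: dot_scale_left)
  then show ?thesis
    using assms by (subst (1 2) transvection_mult_transvection)
      (simp add: transvection_mult vector_matrix_mult_add_rdistrib vec_mult_outer algebra_simps)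
qed

lemma dot_vmult: "dot (b v* A) c = dot b (A *v c)"
  unfolding dot_def matrix_vector_mult_def vector_matrix_mult_def
  by (simp add: sum_distrib_left sum_distrib_right mult_ac) (rule sum.swap)

lemma det_transvection: "det (transvection a b) = 1 + dot b (a :: _ ^ 3)"
  by (simp add: det_3 vec_eq_iff forall_3 transvection_def outer_def dot_def mat_def sum_3
    algebra_simps)

definition elementary :: "'n \<Rightarrow> 'n \<Rightarrow> 'a \<Rightarrow> 'a::comm_ring_1 ^ 'n ^ 'n" where
  "elementary i j c = transvection (axis i 1) (axis j c)"

lemma elementary_mult_row:
  fixes A :: "'a::comm_ring_1 ^ 'n ^ 'n"
  shows "(elementary i j c ** A) $ l = (if l = i then A $ i + c *s A $ j else A $ l)"
proof -
  have "axis j c v* A = c *s A $ j"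
    by (simp add: vector_matrix_mult_def vec_eq_iff axis_def if_distrib if_distribR cong: if_cong)
  then show ?thesis
    by (simp add: elementary_def transvection_mult outer_def vec_eq_iff axis_def)
qed

lemma det_elementary_mult:
  assumes "i \<noteq> j" shows "det (elementary i j c ** A) = det A"
proof -
  have "elementary i j c ** A = (\<chi> k. if k = i then row i A + c *s row j A else row k A)"
    by (subst vec_eq_iff) (simp only: elementary_mult_row vec_lambda_beta row_def vec_lambda_eta
      if_True simp_thms split: if_split)
  then show ?thesis by (simp only: det_row_operation[OF assms])
qed

section \<open>Elementary row reduction\<close>

definition row_step :: "'a::comm_ring_1 ^ 'n ^ 'n \<Rightarrow> 'a ^ 'n ^ 'n \<Rightarrow> bool" where
  "row_step A B \<longleftrightarrow> (\<exists>i j c. i \<noteq> j \<and> B = elementary i j c ** A)"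

lemma row_steps_det: "row_step\<^sup>*\<^sup>* A B \<Longrightarrow> det B = det A"
  by (induction rule: rtranclp_induct) (auto simp: row_step_def det_elementary_mult)

lemma row_steps_elementary: "row_step\<^sup>*\<^sup>* A B \<Longrightarrow> i \<noteq> j \<Longrightarrow> row_step\<^sup>*\<^sup>* A (elementary i j c ** B)"
  unfolding row_step_def by (rule rtranclp.rtrancl_into_rtrancl) auto

text \<open>The Euclidean algorithm in column \<open>k\<close>, run on rows \<open>i\<close> and
  \<open>j\<close>. The last conjunct ensures that columns already cleared in both rows stay
  cleared.\<close>

lemma clear_entry:
  fixes A :: "bit poly ^ 'n ^ 'n"
  assumes "i \<noteq> j"
  shows "\<exists>B. row_step\<^sup>*\<^sup>* A B \<and> B $ j $ k = 0 \<and> (\<forall>l. l \<noteq> i \<longrightarrow> l \<noteq> j \<longrightarrow> B $ l = A $ l)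
    \<and> (\<forall>m. A $ i $ m = 0 \<longrightarrow> A $ j $ m = 0 \<longrightarrow> B $ i $ m = 0 \<and> B $ j $ m = 0)"
proof (induction "euclidean_size (A $ j $ k)" arbitrary: A rule: less_induct)
  case less
  show ?case
  proof (cases "A $ j $ k = 0")
    case True
    then show ?thesis by (intro exI[of _ A]) simp
  next
    case False
    \<comment> \<open>One division step. With \<open>s\<close> the quotient, characteristic two
      makes these three row additions turn the rows \<open>(A $ i, A $ j)\<close> into
      \<open>(A $ j, A $ i + s *s A $ j)\<close>; the summand \<open>1\<close> in the first
      coefficient is what produces the swap.\<close>
    define C where "C = elementary i j 1 ** (elementary j i 1 ** (elementary i j (1
      + A $ i $ k div A $ j $ k) ** A))"
    have steps: "row_step\<^sup>*\<^sup>* A C"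
      unfolding C_def using assms
      by (intro row_steps_elementary rtranclp.rtrancl_refl) auto
    have rest: "C $ l = A $ l" if "l \<noteq> i" "l \<noteq> j" for l
      using that by (simp add: C_def elementary_mult_row)
    have cj: "C $ j $ m = A $ i $ m + (A $ i $ k div A $ j $ k) * A $ j $ m" for m
      using assms by (simp add: C_def elementary_mult_row algebra_simps)
    have ci: "C $ i $ m = A $ j $ m" for m
      using assms by (simp add: C_def elementary_mult_row algebra_simps)
    have "C $ j $ k = A $ i $ k mod A $ j $ k"
      unfolding cj by (simp add: minus_mult_div_eq_mod[symmetric] bit_poly_minus mult.commute)
    then have "euclidean_size (C $ j $ k) < euclidean_size (A $ j $ k)"
      using mod_size_less[OF False] by simp
    from less[OF this] obtain B where
      B: "row_step\<^sup>*\<^sup>* C B \<and> B $ j $ k = 0 \<and> (\<forall>l. l \<noteq> i \<longrightarrow> l \<noteq> j \<longrightarrow> B $ l = C $ l)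
      \<and> (\<forall>m. C $ i $ m = 0 \<longrightarrow> C $ j $ m = 0 \<longrightarrow> B $ i $ m = 0 \<and> B $ j $ m = 0)"
      by (elim exE)
    show ?thesis
    proof (intro exI[of _ B] conjI allI impI)
      show "row_step\<^sup>*\<^sup>* A B" using steps B by (meson rtranclp_trans)
    qed (use B rest in \<open>simp_all add: ci cj\<close>)
  qed
qed

text \<open>Clearing below the diagonal leaves a triangular matrix of determinant 1. Its diagonal
  entries are units, hence 1, and back substitution then removes the remaining entries.\<close>

lemma row_steps_identity:
  fixes A :: "bit poly ^ 3 ^ 3"
  assumes "det A = 1"
  shows "row_step\<^sup>*\<^sup>* A (mat 1)"
proof -
  have ne: "(1::3) \<noteq> 2" "(1::3) \<noteq> 3" "(2::3) \<noteq> 3" by auto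
  obtain B where B: "row_step\<^sup>*\<^sup>* A B" "B $ 2 $ 1 = 0"
    using clear_entry[OF ne(1), of A 1] by blast
  obtain C where C: "row_step\<^sup>*\<^sup>* B C" "C $ 3 $ 1 = 0"
    and C': "\<forall>l. l \<noteq> 1 \<longrightarrow> l \<noteq> 3 \<longrightarrow> C $ l = B $ l"
    using clear_entry[OF ne(2), of B 1] by blast
  have "C $ 2 $ 1 = 0" using C' ne B(2) by simp
  then obtain D where D: "row_step\<^sup>*\<^sup>* C D" "D $ 3 $ 2 = 0" "D $ 2 $ 1 = 0" "D $ 3 $ 1 = 0"
    using clear_entry[OF ne(3), of C 2] C(2) by blast
  have AD: "row_step\<^sup>*\<^sup>* A D" using B C D by (meson rtranclp_trans)
  have det: "D $ 1 $ 1 * D $ 2 $ 2 * D $ 3 $ 3 = 1"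
    using row_steps_det[OF AD] assms D by (simp add: det_3)
  have diag: "D $ 1 $ 1 = 1" "D $ 2 $ 2 = 1" "D $ 3 $ 3 = 1"
    by (rule bit_poly_unit, simp flip: det)+
  \<comment> \<open>The innermost factor acts first: row 2 must be a unit vector before it is used
    to clear row 1. Adding a multiple equal to the entry clears it, since signs do not
    matter.\<close>
  define E where "E = elementary 1 2 (D $ 1 $ 2) ** (elementary 1 3 (D $ 1 $ 3)
    ** (elementary 2 3 (D $ 2 $ 3) ** D))"
  have "row_step\<^sup>*\<^sup>* D E"
    unfolding E_def using ne
    by (intro row_steps_elementary rtranclp.rtrancl_refl) auto
  moreover have "E = mat 1"
    using D(2-4) diag by (simp add: E_def vec_eq_iff forall_3 elementary_mult_row mat_def
      algebra_simps)
  ultimately show ?thesis using AD by simp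
qed

lemma elementary_involution: "i \<noteq> j \<Longrightarrow>
  elementary i j c ** (elementary i j c ** A) = (A :: bit poly ^ 'n ^ 'n)"
  by (simp add: vec_eq_iff[of _ A] elementary_mult_row) (simp add: vec_eq_iff)

text \<open>Elementary matrices are involutions in characteristic two, so a reduction of
  \<open>A\<close> to the identity, read backwards, builds \<open>A\<close> from the
  identity.\<close>

lemma SL3_induct [consumes 1, case_names one step]:
  fixes A :: "bit poly ^ 3 ^ 3"
  assumes "det A = 1" and one: "P (mat 1)"
    and step: "\<And>A i j c. i \<noteq> j \<Longrightarrow> P A \<Longrightarrow> P (elementary i j c ** A)"
  shows "P A"
  using row_steps_identity[OF assms(1)]
proof (induction rule: converse_rtranclp_induct)
  case base
  then show ?case by (rule one)
next
  case (step A B)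
  then obtain i j c where "i \<noteq> j" "B = elementary i j c ** A" unfolding row_step_def by blast
  then show ?case using assms(3)[of i j B c] step.IH by (simp add: elementary_involution)
qed

lemma vector3_eta: "v = vector [v $ 1, v $ 2, v $ (3 :: 3)]"
  by (simp add: vec_eq_iff forall_3)

lemma vector3_add: "vector [a, b, c] + vector [a', b', c']
  = (vector [a + a', b + b', c + c'] :: _ ^ 3)"
  by (simp add: vec_eq_iff forall_3)

lemma vector3_0: "vector [0, 0, 0] = (0 :: _ ^ 3)"
  by (simp add: vec_eq_iff forall_3)

lemma dot_vector3: "dot (vector [a, b, c]) (vector [a', b', c'] :: _ ^ 3)
  = a * a' + b * b' + c * c'"
  by (simp add: dot_def sum_3)

section \<open>Biadditive functions on flags\<close>

locale flag_biadditive = comm_group Q for Q (structure) +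
  fixes y :: "bit ^ 3 \<Rightarrow> bit ^ 3 \<Rightarrow> 'a"
  assumes closed: "dot u v = 0 \<Longrightarrow> y u v \<in> carrier Q"
    and add_left: "dot u v = 0 \<Longrightarrow> dot u' v = 0 \<Longrightarrow> y (u + u') v = y u v \<otimes> y u' v"
    and add_right: "dot u v = 0 \<Longrightarrow> dot u v' = 0 \<Longrightarrow> y u (v + v') = y u v \<otimes> y u v'"
begin

text \<open>Obtained by writing a trace-zero matrix \<open>M\<close> as a sum of five matrices \<open>u v\<^sup>T\<close> with the pairs
  \<open>(u, v)\<close> that occur here; see \<open>linear_part_onto\<close>.\<close>

definition matrix_image :: "bit ^ 3 ^ 3 \<Rightarrow> 'a" where
  "matrix_image M =
     y (vector [1, 0, 0]) (vector [0, M $ 1 $ 2 + M $ 1 $ 1, M $ 1 $ 3])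
   \<otimes> y (vector [0, 1, 0]) (vector [M $ 2 $ 1 + M $ 1 $ 1, 0, M $ 2 $ 3 + M $ 3 $ 3])
   \<otimes> y (vector [0, 0, 1]) (vector [M $ 3 $ 1, M $ 3 $ 2 + M $ 3 $ 3, 0])
   \<otimes> y (vector [1, 1, 0]) (vector [M $ 1 $ 1, M $ 1 $ 1, 0])
   \<otimes> y (vector [0, 1, 1]) (vector [0, M $ 3 $ 3, M $ 3 $ 3])"

lemma matrix_image_closed: "matrix_image M \<in> carrier Q"
  unfolding matrix_image_def by (intro m_closed closed) (simp_all add: dot_vector3)

text \<open>Additivity in coordinates, so that concrete bits can be substituted and the sums
  evaluated.\<close>

lemma add_right3:
  assumes "a * d + b * e + c * f = 0" "a * d' + b * e' + c * f' = 0"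
  shows "y (vector [a, b, c]) (vector [d + d', e + e', f + f'])
    = y (vector [a, b, c]) (vector [d, e, f]) \<otimes> y (vector [a, b, c]) (vector [d', e', f'])"
  using assms add_right[of "vector [a, b, c]" "vector [d, e, f]" "vector [d', e', f']"]
  by (simp add: dot_vector3 vector3_add)

lemma add_left3:
  assumes "a * d + b * e + c * f = 0" "a' * d + b' * e + c' * f = 0"
  shows "y (vector [a + a', b + b', c + c']) (vector [d, e, f])
    = y (vector [a, b, c]) (vector [d, e, f]) \<otimes> y (vector [a', b', c']) (vector [d, e, f])"
  using assms add_left[of "vector [a, b, c]" "vector [d, e, f]" "vector [a', b', c']"]
  by (simp add: dot_vector3 vector3_add)

text \<open>In each of the five factors the left vector is fixed and the right vector depends
  linearly on the matrix.\<close>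

lemma matrix_image_add: "matrix_image (M + N) = matrix_image M \<otimes> matrix_image N"
proof -
  have 1: "y (vector [1, 0, 0]) (vector [0, (M + N) $ 1 $ 2 + (M + N) $ 1 $ 1, (M + N) $ 1 $ 3])
    = y (vector [1, 0, 0]) (vector [0, M $ 1 $ 2 + M $ 1 $ 1, M $ 1 $ 3])
    \<otimes> y (vector [1, 0, 0]) (vector [0, N $ 1 $ 2 + N $ 1 $ 1, N $ 1 $ 3])"
    using add_right3[of 1 "0" 0 "M $ 1 $ 2 + M $ 1 $ 1" 0 "M $ 1 $ 3" "0" "N $ 1 $ 2 + N $ 1 $ 1"
      "N $ 1 $ 3"]
    by (simp add: ac_simps)
  have 2: "y (vector [0, 1, 0])
      (vector [(M + N) $ 2 $ 1 + (M + N) $ 1 $ 1, 0, (M + N) $ 2 $ 3 + (M + N) $ 3 $ 3])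
    = y (vector [0, 1, 0]) (vector [M $ 2 $ 1 + M $ 1 $ 1, 0, M $ 2 $ 3 + M $ 3 $ 3])
    \<otimes> y (vector [0, 1, 0]) (vector [N $ 2 $ 1 + N $ 1 $ 1, 0, N $ 2 $ 3 + N $ 3 $ 3])"
    using add_right3[of 0 "M $ 2 $ 1 + M $ 1 $ 1" 1 "0" 0 "M $ 2 $ 3 + M $ 3 $ 3"
      "N $ 2 $ 1 + N $ 1 $ 1" "0" "N $ 2 $ 3 + N $ 3 $ 3"]
    by (simp add: ac_simps)
  have 3: "y (vector [0, 0, 1]) (vector [(M + N) $ 3 $ 1, (M + N) $ 3 $ 2 + (M + N) $ 3 $ 3, 0])
    = y (vector [0, 0, 1]) (vector [M $ 3 $ 1, M $ 3 $ 2 + M $ 3 $ 3, 0])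
    \<otimes> y (vector [0, 0, 1]) (vector [N $ 3 $ 1, N $ 3 $ 2 + N $ 3 $ 3, 0])"
    using add_right3[of 0 "M $ 3 $ 1" 0 "M $ 3 $ 2 + M $ 3 $ 3" 1 "0"
      "N $ 3 $ 1" "N $ 3 $ 2 + N $ 3 $ 3" "0"]
    by (simp add: ac_simps)
  have 4: "y (vector [1, 1, 0]) (vector [(M + N) $ 1 $ 1, (M + N) $ 1 $ 1, 0])
    = y (vector [1, 1, 0]) (vector [M $ 1 $ 1, M $ 1 $ 1, 0])
    \<otimes> y (vector [1, 1, 0]) (vector [N $ 1 $ 1, N $ 1 $ 1, 0])"
    using add_right3[of 1 "M $ 1 $ 1" 1 "M $ 1 $ 1" 0 "0" "N $ 1 $ 1" "N $ 1 $ 1" "0"]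
    by (simp add: ac_simps)
  have 5: "y (vector [0, 1, 1]) (vector [0, (M + N) $ 3 $ 3, (M + N) $ 3 $ 3])
    = y (vector [0, 1, 1]) (vector [0, M $ 3 $ 3, M $ 3 $ 3])
    \<otimes> y (vector [0, 1, 1]) (vector [0, N $ 3 $ 3, N $ 3 $ 3])"
    using add_right3[of 0 "0" 1 "M $ 3 $ 3" 1 "M $ 3 $ 3" "0" "N $ 3 $ 3" "N $ 3 $ 3"]
    by (simp add: ac_simps)
  show ?thesis
    unfolding matrix_image_def 1 2 3 4 5 by (simp add: m_ac closed dot_vector3)
qed

lemma zero_right: "y u 0 = \<one>"
  using add_right[of u 0 0] closed[of u 0] by (simp add: dot_def)

lemma zero_left: "y 0 v = \<one>"
  using add_left[of 0 v 0] closed[of 0 v] by (simp add: dot_def)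

lemma square:
  assumes "dot u v = 0" shows "y u v \<otimes> y u v = \<one>"
proof -
  have "v + v = 0" by (simp only: vec_eq_iff vector_add_component bit_add_self zero_index) simp
  then show ?thesis using add_right[OF assms assms] zero_right[of u] by metis
qed

text \<open>Biadditivity expresses 13 of the 21 flag values through the other eight, which are the
  six at pairs of distinct coordinate vectors and those at \<open>u = v = (1, 1, 0)\<close> and
  \<open>u = v = (0, 1, 1)\<close>. Both sides are compared in this normal form.\<close>

lemma eq_matrix_image:
  assumes "dot u v = 0"
  shows "y u v = matrix_image (outer u v)"
proof -
  define Y where
    "Y a b c d e f = y (vector [a, b, c]) (vector [d, e, f])" for a b c d e f
  have closed': "Y a b c d e f \<in> carrier Q" if "a * d + b * e + c * f = 0" for a b c d e f
    using that closed by (simp add: Y_def dot_vector3)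
  have sq: "Y a b c d e f \<otimes> Y a b c d e f = \<one>" if "a * d + b * e + c * f = 0" for a b c d e f
    using that square by (simp add: Y_def dot_vector3)
  have cancel: "Y a b c d e f \<otimes> (Y a b c d e f \<otimes> x) = x"
    if "a * d + b * e + c * f = 0" "x \<in> carrier Q" for a b c d e f x
    using that sq[of a d b e c f] closed'[of a d b e c f] by (simp flip: m_assoc)
  have zero: "Y 0 0 0 d e f = \<one>" "Y a b c 0 0 0 = \<one>" for a b c d e f
    by (simp_all add: Y_def vector3_0 zero_left zero_right)
  note R = add_right3[folded Y_def] and L = add_left3[folded Y_def]
  \<comment> \<open>Flags in which one vector is a coordinate vector and the other has weight
    two.\<close>
  have axes: "Y 1 0 0 0 1 1 = Y 1 0 0 0 1 0 \<otimes> Y 1 0 0 0 0 1"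
      "Y 0 1 0 1 0 1 = Y 0 1 0 1 0 0 \<otimes> Y 0 1 0 0 0 1"
      "Y 0 0 1 1 1 0 = Y 0 0 1 1 0 0 \<otimes> Y 0 0 1 0 1 0"
      "Y 1 1 0 0 0 1 = Y 1 0 0 0 0 1 \<otimes> Y 0 1 0 0 0 1"
      "Y 0 1 1 1 0 0 = Y 0 1 0 1 0 0 \<otimes> Y 0 0 1 1 0 0"
      "Y 1 0 1 0 1 0 = Y 1 0 0 0 1 0 \<otimes> Y 0 0 1 0 1 0"
    using R[of 1 0 0 1 0 0 0 0 1] R[of 0 1 1 0 0 0 0 0 1] R[of 0 1 0 0 1 0 0 1 0]
     L[of 1 0 0 0 0 1 0 1 0] L[of 0 1 1 0 0 0 0 0 1] L[of 1 0 0 1 0 0 0 0 1] by simp_all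
  \<comment> \<open>Flags in which one vector is \<open>(1, 1, 1)\<close>.\<close>
  have planes: "Y 1 1 0 1 1 1 = Y 1 1 0 1 1 0 \<otimes> Y 1 1 0 0 0 1"
      "Y 0 1 1 1 1 1 = Y 0 1 1 0 1 1 \<otimes> Y 0 1 1 1 0 0"
      "Y 1 0 1 1 1 1 = Y 1 0 1 1 0 1 \<otimes> Y 1 0 1 0 1 0"
      "Y 1 1 1 1 1 0 = Y 1 1 0 1 1 0 \<otimes> Y 0 0 1 1 1 0"
      "Y 1 1 1 0 1 1 = Y 0 1 1 0 1 1 \<otimes> Y 1 0 0 0 1 1"
      "Y 1 1 1 1 0 1 = Y 1 0 1 1 0 1 \<otimes> Y 0 1 0 1 0 1"
    using R[of 1 1 1 1 0 0 0 0 1] R[of 0 0 1 1 1 1 1 0 0] R[of 1 1 0 0 1 1 0 1 0]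
     L[of 1 1 1 1 0 0 0 0 1] L[of 0 0 1 1 1 1 1 0 0] L[of 1 1 0 0 1 1 0 1 0] by simp_all
  \<comment> \<open>The only relation that does more than eliminate a generator: additivity in \<open>v\<close> at
    \<open>u = (1, 1, 1)\<close>.\<close>
  have "Y 1 1 1 1 0 1 = Y 1 1 1 1 1 0 \<otimes> Y 1 1 1 0 1 1"
    using R[of 1 1 1 1 1 0 0 1 1] by simp
  moreover have "Y 1 0 1 1 0 1 = Y 1 1 1 1 0 1 \<otimes> Y 0 1 0 1 0 1"
    unfolding planes(6) using sq[of 0 1 1 0 0 1] by (simp add: m_assoc closed')
  ultimately have last: "Y 1 0 1 1 0 1 = Y 1 1 1 1 1 0 \<otimes> Y 1 1 1 0 1 1 \<otimes> Y 0 1 0 1 0 1"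
    by simp
  obtain a b c d e f where uv: "u = vector [a, b, c]" "v = vector [d, e, f]"
    using vector3_eta by metis
  \<comment> \<open>Over all bit values, \<open>axes\<close>, \<open>planes\<close> and
    \<open>last\<close> rewrite both sides to the eight remaining values, whose repetitions cancel
    because every value squares to \<open>\<one>\<close>.\<close>
  have goal: "a * d + b * e + c * f = 0 \<Longrightarrow>
    Y a b c d e f = Y 1 0 0 0 (a * e + a * d) (a * f)
    \<otimes> Y 0 1 0 (b * d + a * d) 0 (b * f + c * f)
    \<otimes> Y 0 0 1 (c * d) (c * e + c * f) 0
    \<otimes> Y 1 1 0 (a * d) (a * d) 0 \<otimes> Y 0 1 1 0 (c * f) (c * f)"
    by (cases a; cases b; cases c; cases d; cases e; cases f)
      (simp_all add: zero axes planes last closed' cancel sq m_ac)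
  then show ?thesis
    using assms by (simp add: uv dot_vector3 matrix_image_def outer_def Y_def)
qed

end

section \<open>Generators of the congruence subgroup\<close>

definition const_vec :: "'a::comm_ring_1 ^ 'n \<Rightarrow> 'a poly ^ 'n" where
  "const_vec u = (\<chi> i. [:u $ i:])"

definition const_mat :: "'a::comm_ring_1 ^ 'n ^ 'n \<Rightarrow> 'a poly ^ 'n ^ 'n" where
  "const_mat A = (\<chi> i j. [:A $ i $ j:])"

definition coeff_mat :: "nat \<Rightarrow> 'a::comm_ring_1 poly ^ 'n ^ 'n \<Rightarrow> 'a ^ 'n ^ 'n" where
  "coeff_mat k A = (\<chi> i j. poly.coeff (A $ i $ j) k)"

text \<open>As \<open>pCons 0 f\<close> is \<open>t f\<close>, this is \<open>1 + t f u v^T\<close>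
  with constant vectors \<open>u\<close> and \<open>v\<close>.\<close>

definition cong_transvection :: "'a::comm_ring_1 ^ 'n \<Rightarrow> 'a ^ 'n \<Rightarrow> 'a poly \<Rightarrow> 'a poly ^ 'n ^ 'n" where
  "cong_transvection u v f = transvection (const_vec u) (pCons 0 f *s const_vec v)"

lemma const_poly_sum: "(\<Sum>i\<in>I. [:f i:]) = [:\<Sum>i\<in>I. f i:]"
  by (induction I rule: infinite_finite_induct) auto

lemma const_mat_mult: "const_mat (A ** B) = const_mat A ** const_mat B"
  by (simp add: const_mat_def matrix_matrix_mult_def vec_eq_iff const_poly_sum mult.commute)

lemma const_mat_1: "const_mat (mat 1) = mat 1"
  by (simp add: const_mat_def mat_def vec_eq_iff one_pCons)

lemma const_mat_vec: "const_mat A *v const_vec u = const_vec (A *v u)"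
  by (simp add: const_mat_def const_vec_def matrix_vector_mult_def vec_eq_iff const_poly_sum
    mult.commute)

lemma const_vec_mat: "const_vec u v* const_mat A = const_vec (u v* A)"
  by (simp add: const_mat_def const_vec_def vector_matrix_mult_def vec_eq_iff const_poly_sum
    mult.commute)

lemma const_vec_add: "const_vec (u + v) = const_vec u + const_vec v"
  by (simp add: const_vec_def vec_eq_iff)

lemma dot_const_vec: "dot (const_vec u) (const_vec v) = [:dot u v:]"
  by (simp add: const_vec_def dot_def const_poly_sum mult.commute)

lemma coeff_mat_0_mult: "coeff_mat 0 (A ** B) = coeff_mat 0 A ** coeff_mat 0 B"
  by (simp add: coeff_mat_def matrix_matrix_mult_def vec_eq_iff coeff_sum coeff_mult_0)

lemma coeff_mult_1: "poly.coeff (p * q) (Suc 0)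
  = poly.coeff p 0 * poly.coeff q (Suc 0) + poly.coeff p (Suc 0) * poly.coeff q 0"
  by (simp add: coeff_mult)

lemma coeff_mat_1_mult:
  "coeff_mat 1 (A ** B) = coeff_mat 0 A ** coeff_mat 1 B + coeff_mat 1 A ** coeff_mat 0 B"
  by (simp add: coeff_mat_def matrix_matrix_mult_def vec_eq_iff coeff_sum coeff_mult_1 sum.distrib)

lemma coeff_mat_const: "coeff_mat 0 (const_mat A) = A"
  by (simp add: coeff_mat_def const_mat_def vec_eq_iff)

lemma coeff_mat_1_one: "coeff_mat 1 (mat 1) = 0"
  by (simp add: coeff_mat_def mat_def vec_eq_iff)

lemma coeff_mat_0_one: "coeff_mat 0 (mat 1) = mat 1"
  by (simp add: coeff_mat_def mat_def vec_eq_iff)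

lemma coeff_mat_cong_transvection:
  "coeff_mat 0 (cong_transvection u v f) = mat 1"
  "coeff_mat 1 (cong_transvection u v f) = outer u (poly.coeff f 0 *s v)"
  by (simp_all add: cong_transvection_def coeff_mat_def transvection_def outer_def mat_def
    vec_eq_iff const_vec_def)

lemma cong_transvection_dot: "dot u v = 0 \<Longrightarrow> dot (pCons 0 f *s const_vec v) (const_vec u) = 0"
  by (simp add: dot_scale_left dot_const_vec dot_commute[of v u])

lemma cong_transvection_add: "dot u v = 0 \<Longrightarrow>
  cong_transvection u v f ** cong_transvection u v g = cong_transvection u v (f + g)"
  unfolding cong_transvection_def by (subst transvection_add_right)
    (simp_all add: cong_transvection_dot flip: vector_sadd_rdistrib)

lemma cong_transvection_add_right: "dot u v = 0 \<Longrightarrow>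
  cong_transvection u v f ** cong_transvection u v' f = cong_transvection u (v + v') f"
  unfolding cong_transvection_def by (subst transvection_add_right)
    (simp_all add: cong_transvection_dot const_vec_add vector_add_ldistrib)

lemma cong_transvection_add_left: "dot u' v = 0 \<Longrightarrow>
  cong_transvection u v f ** cong_transvection u' v f = cong_transvection (u + u') v f"
  unfolding cong_transvection_def by (subst transvection_add_left)
    (simp_all add: cong_transvection_dot const_vec_add)

lemma cong_transvection_scale: "cong_transvection u v [:c:] = cong_transvection u (c *s v) 1"
  by (simp add: cong_transvection_def const_vec_def vector_scalar_mult_def vec_eq_iff
    transvection_def outer_def one_pCons)

lemma scale_vec_mat: "(c *s b) v* A = c *s (b v* (A :: 'a::comm_ring_1 ^ 'm ^ 'n))"
  by (simp add: vector_matrix_mult_def vec_eq_iff sum_distrib_left mult.assoc)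

lemma cong_transvection_conjugate:
  assumes "g ** h = mat 1"
  shows "const_mat g ** cong_transvection u v f ** const_mat h
    = cong_transvection (g *v u) (v v* h) f"
proof -
  have "const_mat g ** const_mat h = mat 1"
    using assms by (simp add: const_mat_1 flip: const_mat_mult)
  then show ?thesis
    by (simp add: cong_transvection_def transvection_conjugate const_mat_vec const_vec_mat
      scale_vec_mat)
qed

text \<open>Each factor contributes one \<open>t\<close>, so the commutator carries
  \<open>t^2 f\<close>, which is \<open>t\<close> times \<open>pCons 0 f\<close>. Hence
  transvections whose coefficient is divisible by \<open>t\<close> are commutators of elements of
  the congruence subgroup.\<close>

lemma cong_transvection_commutator:
  assumes "dot u v = 0" "dot u w = 0" "dot w' v = 0" "dot w w' = 1"
  shows "cong_transvection u w 1 ** cong_transvection w' v f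
    = cong_transvection u v (pCons 0 f) ** (cong_transvection w' v f ** cong_transvection u w 1)"
proof -
  have "pCons 0 1 * pCons 0 f = pCons 0 (pCons 0 f)" by simp
  moreover have "dot (pCons 0 1 *s const_vec w) (const_vec w') = pCons 0 1"
    using assms(4) by (simp add: dot_scale_left dot_const_vec)
  ultimately show ?thesis
    unfolding cong_transvection_def using assms
    by (subst transvection_commutator)
      (simp_all add: dot_scale_left dot_scale_right dot_const_vec dot_commute vector_smult_assoc)
qed

lemma all_bit: "(\<forall>x::bit. P x) \<longleftrightarrow> P 0 \<and> P 1"
  by (metis bit.exhaust)

lemma ex_bit: "(\<exists>x::bit. P x) \<longleftrightarrow> P 0 \<or> P 1"
  by (metis bit.exhaust)

text \<open>The orthogonal complements of \<open>u\<close> and of \<open>v\<close> are planes in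
  3-space, too large to be orthogonal to each other. Over the two-element field this is checked by
  enumeration.\<close>

lemma transversal_flags:
  fixes u v :: "bit ^ 3"
  assumes "u \<noteq> 0" "v \<noteq> 0" "dot u v = 0"
  obtains w w' where "dot u w = 0" "dot w' v = 0" "dot w w' = 1"
proof -
  have bits: "\<forall>a b c d e f :: bit. (a, b, c) \<noteq> (0, 0, 0) \<longrightarrow> (d, e, f) \<noteq> (0, 0, 0) \<longrightarrow>
    a * d + b * e + c * f = 0 \<longrightarrow>
     (\<exists>a' b' c' d' e' f'. a * a' + b * b' + c * c' = 0 \<and> d' * d + e' * e + f' * f = 0
       \<and> a' * d' + b' * e' + c' * f' = 1)"
    by (simp add: all_bit ex_bit)
  obtain a b c d e f where uv: "u = vector [a, b, c]" "v = vector [d, e, f]"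
    using vector3_eta by metis
  have "(a, b, c) \<noteq> (0, 0, 0)" "(d, e, f) \<noteq> (0, 0, 0)"
    using assms(1,2) vector3_0 unfolding uv prod.inject by metis+
  moreover have "a * d + b * e + c * f = 0"
    using assms(3) by (simp add: uv dot_vector3)
  ultimately obtain a' b' c' d' e' f' where
    "a * a' + b * b' + c * c' = 0" "d' * d + e' * e + f' * f = 0"
       "a' * d' + b' * e' + c' * f' = 1"
    using bits by meson
  then show ?thesis
    by (intro that[of "vector [a', b', c']" "vector [d', e', f']"]) (simp_all add: uv dot_vector3)
qed

text \<open>Products suffice to obtain a group, because each generator is its own inverse.\<close>

inductive_set transvection_span :: "(bit poly ^ 3 ^ 3) set" where
  one: "mat 1 \<in> transvection_span"
| step: "dot u v = 0 \<Longrightarrow> A \<in> transvection_span \<Longrightarrow> cong_transvection u v f ** A \<in> transvection_span"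

lemma transvection_span_mult:
  assumes "A \<in> transvection_span" "B \<in> transvection_span" shows "A ** B \<in> transvection_span"
  using assms(1) by induction (auto simp: assms(2) intro: transvection_span.step simp flip:
    matrix_mul_assoc)

lemma cong_transvection_in_span: "dot u v = 0 \<Longrightarrow> cong_transvection u v f \<in> transvection_span"
  using transvection_span.step[OF _ transvection_span.one] by simp

text \<open>Conjugation by a constant matrix moves a flag to another flag. This is why generators
  are taken for all orthogonal pairs and not only for coordinate vectors.\<close>

lemma transvection_span_conjugate:
  assumes "g ** h = mat 1" "h ** g = mat 1" "A \<in> transvection_span"
  shows "const_mat g ** A ** const_mat h \<in> transvection_span"
  using assms(3)
proof induction
  case one
  show ?case using assms(1) by (simp add: const_mat_1 transvection_span.one flip: const_mat_mult)
next
  case (step u v A f)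
  have hg: "const_mat h ** const_mat g = (mat 1 :: bit poly ^ 3 ^ 3)"
    using assms(2) by (simp add: const_mat_1 flip: const_mat_mult)
  have "const_mat g ** (cong_transvection u v f ** A) ** const_mat h
    = const_mat g ** cong_transvection u v f ** (const_mat h ** const_mat g) ** A ** const_mat h"
    unfolding hg by (simp add: matrix_mul_assoc)
  also have "\<dots> = cong_transvection (g *v u) (v v* h) f ** (const_mat g ** A ** const_mat h)"
    by (simp add: matrix_mul_assoc flip: cong_transvection_conjugate[OF assms(1)])
  finally have "const_mat g ** (cong_transvection u v f ** A) ** const_mat h
    = cong_transvection (g *v u) (v v* h) f ** (const_mat g ** A ** const_mat h)" .
  moreover have "dot (g *v u) (v v* h) = 0"
    using step.hyps(1) assms(2)
    by (simp add: dot_commute[of "g *v u"] dot_vmult matrix_vector_mul_assoc dot_commute[of v])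
  ultimately show ?case using step.IH by (simp add: transvection_span.step)
qed

lemma const_mat_elementary: "const_mat (elementary i j c) = elementary i j [:c:]"
  by (simp add: const_mat_def elementary_def transvection_def outer_def mat_def axis_def
    vec_eq_iff one_pCons)

lemma elementary_add:
  assumes "i \<noteq> j" shows "elementary i j c ** elementary i j d = elementary i j (c + d)"
proof -
  have "dot (axis j c) (axis i 1) = 0" "axis j c + axis j d = axis j (c + d)"
    using assms by (simp_all add: dot_def axis_def vec_eq_iff if_distrib if_distribR cong: if_cong)
  then show ?thesis by (simp add: elementary_def transvection_add_right)
qed

lemma elementary_0: "elementary i j 0 = mat 1"
  by (simp add: elementary_def axis_def zero_vec_def[symmetric])

lemma cong_transvection_axis:
  "cong_transvection (axis i 1) (axis j 1) f = elementary i j (pCons 0 f)"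
  by (simp add: cong_transvection_def elementary_def transvection_def outer_def const_vec_def
    axis_def vec_eq_iff)

lemma elementary_split:
  assumes "i \<noteq> j"
  shows "elementary i j (pCons c f)
    = cong_transvection (axis i 1) (axis j 1) f ** elementary i j [:c:]"
  by (simp add: cong_transvection_axis elementary_add[OF assms])

text \<open>An elementary matrix with entry \<open>c + t f\<close> splits into a generator and a
  constant matrix; the constant matrix is moved to the right past \<open>B\<close> by
  conjugation.\<close>

lemma span_const_factorization:
  assumes "det A = 1"
  shows "\<exists>B g. B \<in> transvection_span \<and> A = B ** const_mat g"
  using assms
proof (induction rule: SL3_induct)
  case one
  show ?case using transvection_span.one const_mat_1 by (metis matrix_mul_lid)
next
  case (step A i j p)
  obtain c f where p: "p = pCons c f" by (cases p)
  obtain B g where B: "B \<in> transvection_span" "A = B ** const_mat g" using step.IH by blast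
  define e where "e = elementary i j c"
  have ee: "e ** e = mat 1" unfolding e_def elementary_add[OF step.hyps]
    by (simp only: bit_add_self elementary_0)
  have cee: "const_mat e ** const_mat e = mat 1"
    using ee by (simp add: const_mat_1 flip: const_mat_mult)
  \<comment> \<open>The identity \<open>const_mat e ** const_mat e\<close> is inserted after
    \<open>B\<close> to form the conjugate of \<open>B\<close>.\<close>
  have "elementary i j p ** A = cong_transvection (axis i 1) (axis j 1) f ** const_mat e ** B
    ** (const_mat e ** const_mat e) ** const_mat g"
    unfolding cee p elementary_split[OF step.hyps, of c f]
    by (simp add: e_def B(2) const_mat_elementary matrix_mul_assoc)
  also have "\<dots> = (cong_transvection (axis i 1) (axis j 1) f ** (const_mat e ** B ** const_mat e))
    ** const_mat (e ** g)"
    by (simp add: const_mat_mult matrix_mul_assoc)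
  finally have "elementary i j p ** A
    = (cong_transvection (axis i 1) (axis j 1) f ** (const_mat e ** B ** const_mat e))
    ** const_mat (e ** g)" .
  moreover have "cong_transvection (axis i 1) (axis j 1) f ** (const_mat e ** B ** const_mat e)
    \<in> transvection_span"
    by (intro transvection_span.step transvection_span_conjugate ee B(1))
      (use step.hyps in \<open>simp add: dot_def axis_def if_distrib if_distribR cong: if_cong\<close>)
  ultimately show ?case by blast
qed

text \<open>Reduction modulo \<open>t\<close> sends the span to the identity, so the constant factor
  of \<open>A\<close> must be trivial.\<close>

lemma unipotent_in_span:
  assumes "det A = 1" "coeff_mat 0 A = mat 1"
  shows "A \<in> transvection_span"
proof -
  obtain B g where B: "B \<in> transvection_span" "A = B ** const_mat g"
    using span_const_factorization[OF assms(1)] by blast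
  from B(1) have "coeff_mat 0 B = mat 1"
    by induction (simp_all add: coeff_mat_0_one coeff_mat_0_mult coeff_mat_cong_transvection)
  then have "g = mat 1" using assms(2) by (simp add: B(2) coeff_mat_0_mult coeff_mat_const)
  then show ?thesis using B by (simp add: const_mat_1)
qed

section \<open>The congruence subgroup and its linear part\<close>

abbreviation (input) K3 :: "(bit poly ^ 3 ^ 3) monoid" where
  "K3 \<equiv> principal_congruence_group"

abbreviation (input) sl3 :: "(bit ^ 3 ^ 3) monoid" where
  "sl3 \<equiv> sl_additive_group"

lemma cong_pCons_0_1_iff: "[p = q] (mod [:0, 1:]) \<longleftrightarrow> poly.coeff p 0 = poly.coeff q 0"
  for p q :: "'a::field poly"
  by (simp add: cong_iff_dvd_diff dvd_iff_poly_eq_0[of 0, simplified] poly_0_coeff_0)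

lemma carrier_principal_congruence_group:
  "carrier principal_congruence_group = {A. det A = 1 \<and> coeff_mat 0 A = mat 1}"
  by (auto simp: principal_congruence_group_def principal_congruence_subgroup_def
      special_linear_group_def cong_pCons_0_1_iff coeff_mat_def vec_eq_iff mat_def)

lemma mult_principal_congruence_group [simp]: "x \<otimes>\<^bsub>principal_congruence_group\<^esub> y = x ** y"
  and one_principal_congruence_group [simp]: "\<one>\<^bsub>principal_congruence_group\<^esub> = mat 1"
  by (simp_all add: principal_congruence_group_def special_linear_group_def)

lemma carrier_K3_eq_span: "carrier K3 = transvection_span"
proof
  show "carrier K3 \<subseteq> transvection_span"
    by (auto simp: carrier_principal_congruence_group intro: unipotent_in_span)
  have "det A = 1 \<and> coeff_mat 0 A = mat 1" if "A \<in> transvection_span" for A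
    using that
    by induction
      (simp_all add: det_mul coeff_mat_0_one coeff_mat_0_mult coeff_mat_cong_transvection,
        simp add: cong_transvection_def det_transvection cong_transvection_dot)
  then show "transvection_span \<subseteq> carrier K3" by (auto simp: carrier_principal_congruence_group)
qed

lemma cong_transvection_self_inverse: "dot u v = 0 \<Longrightarrow>
  cong_transvection u v f ** cong_transvection u v f = (mat 1 :: bit poly ^ 'n ^ 'n)"
  by (simp add: cong_transvection_add) (simp add: cong_transvection_def)

text \<open>Left inverses are built along the span: each new generator on the left of
  \<open>A\<close> is appended on the right of the inverse.\<close>

lemma group_K3: "group K3"
proof (rule groupI)
  fix A assume "A \<in> carrier K3"
  then have "A \<in> transvection_span" by (simp add: carrier_K3_eq_span)
  then have "\<exists>B\<in>transvection_span. B ** A = mat 1"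
  proof induction
    case one
    then show ?case using transvection_span.one by (metis matrix_mul_lid)
  next
    case (step u v A f)
    then obtain B where B: "B \<in> transvection_span" "B ** A = mat 1" by blast
    have "B ** cong_transvection u v f ** (cong_transvection u v f ** A)
      = B ** (cong_transvection u v f ** cong_transvection u v f) ** A"
      by (simp add: matrix_mul_assoc)
    also have "\<dots> = mat 1" using B by (simp add: cong_transvection_self_inverse[OF step.hyps(1)])
    finally show ?case
      using transvection_span_mult[OF B(1) cong_transvection_in_span[OF step.hyps(1)]] by blast
  qed
  then show "\<exists>B\<in>carrier K3. B \<otimes>\<^bsub>K3\<^esub> A = \<one>\<^bsub>K3\<^esub>" by (simp add: carrier_K3_eq_span)
qed (auto simp: carrier_K3_eq_span transvection_span_mult transvection_span.one matrix_mul_assoc)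

text \<open>Both constant terms are the identity, so the product rule for the coefficient of
  \<open>t\<close> becomes a sum.\<close>

lemma coeff_mat_1_span_mult:
  assumes "A \<in> transvection_span" "B \<in> transvection_span"
  shows "coeff_mat 1 (A ** B) = coeff_mat 1 A + coeff_mat 1 B"
proof -
  have "coeff_mat 0 A = mat 1" "coeff_mat 0 B = mat 1"
    using assms unfolding carrier_K3_eq_span[symmetric]
    by (simp_all add: carrier_principal_congruence_group)
  then show ?thesis by (simp add: coeff_mat_1_mult add.commute del: One_nat_def)
qed

section \<open>Homomorphisms to abelian groups\<close>

locale abelian_image = comm_group Q for Q (structure) +
  fixes q :: "bit poly ^ 3 ^ 3 \<Rightarrow> 'a"
  assumes hom: "q \<in> hom K3 Q"
begin

lemma q_closed: "A \<in> transvection_span \<Longrightarrow> q A \<in> carrier Q"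
  using hom by (auto simp: hom_def carrier_K3_eq_span)

lemma q_mult: "A \<in> transvection_span \<Longrightarrow> B \<in> transvection_span \<Longrightarrow> q (A ** B) = q A \<otimes> q B"
  using hom by (simp add: hom_def carrier_K3_eq_span)

lemma q_one: "q (mat 1) = \<one>"
  using q_mult[OF transvection_span.one transvection_span.one] q_closed[OF transvection_span.one]
    by simp

sublocale flag_biadditive Q "\<lambda>u v. q (cong_transvection u v 1)"
proof
  fix u u' v v' :: "bit ^ 3"
  show "q (cong_transvection u v 1) \<in> carrier Q" if "dot u v = 0"
    using that by (intro q_closed cong_transvection_in_span)
  show "q (cong_transvection (u + u') v 1)
    = q (cong_transvection u v 1) \<otimes> q (cong_transvection u' v 1)" if "dot u v = 0" "dot u' v = 0"
    using that by (simp add: cong_transvection_in_span flip: q_mult cong_transvection_add_left)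
  show "q (cong_transvection u (v + v') 1)
    = q (cong_transvection u v 1) \<otimes> q (cong_transvection u v' 1)" if "dot u v = 0" "dot u v' = 0"
    using that by (simp add: cong_transvection_in_span flip: q_mult cong_transvection_add_right)
qed

text \<open>In the abelian group the commutator relation reads
  \<open>x \<otimes> y = z \<otimes> (y \<otimes> x)\<close>, which forces
  \<open>z = \<one>\<close>. If \<open>u\<close> or \<open>v\<close> is zero, the transvection is
  the identity.\<close>

lemma q_cong_transvection_pCons_0:
  assumes "dot u v = 0" shows "q (cong_transvection u v (pCons 0 f)) = \<one>"
proof (cases "u = 0 \<or> v = 0")
  case True
  then have "cong_transvection u v (pCons 0 f) = mat 1"
    by (auto simp: cong_transvection_def const_vec_def transvection_def outer_def vec_eq_iff)
  then show ?thesis by (simp add: q_one)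
next
  case False
  then obtain w w' where w: "dot u w = 0" "dot w' v = 0" "dot w w' = 1"
    using transversal_flags[OF _ _ assms] by blast
  have "q (cong_transvection u w 1) \<otimes> q (cong_transvection w' v f)
    = q (cong_transvection u v (pCons 0 f)) \<otimes> (q (cong_transvection w' v f)
    \<otimes> q (cong_transvection u w 1))"
    using cong_transvection_commutator[OF assms w, of f] w assms
    by (simp add: cong_transvection_in_span transvection_span_mult flip: q_mult)
  then show ?thesis
    using w assms
    by (simp add: cong_transvection_in_span q_closed m_comm[of "q (cong_transvection w' v f)"])
qed

text \<open>Only the constant coefficient \<open>c\<close> of \<open>f\<close> survives under
  \<open>q\<close>, and it can be absorbed into \<open>v\<close>; the flag \<open>(u, c v)\<close>
  is then covered by \<open>eq_matrix_image\<close>.\<close>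

lemma q_cong_transvection:
  assumes "dot u v = 0"
  shows "q (cong_transvection u v f) = matrix_image (coeff_mat 1 (cong_transvection u v f))"
proof -
  obtain c g where f: "f = pCons c g" by (cases f)
  have cv: "dot u (c *s v) = 0" using assms by (simp add: dot_scale_right)
  have "cong_transvection u v f = cong_transvection u v [:c:] ** cong_transvection u v (pCons 0 g)"
    by (simp add: f cong_transvection_add[OF assms])
  then have "q (cong_transvection u v f) = q (cong_transvection u (c *s v) 1)"
    using assms cv by (simp add: q_mult cong_transvection_in_span q_cong_transvection_pCons_0
      q_closed cong_transvection_scale)
  then show ?thesis using eq_matrix_image[OF cv]
    by (simp add: coeff_mat_cong_transvection f del: One_nat_def)
qed

lemma matrix_image_0: "matrix_image 0 = \<one>"
  using matrix_image_add[of 0 0] matrix_image_closed[of 0] by simp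

text \<open>Both sides turn products into products, so agreement on generators suffices. In
  particular \<open>q\<close> is trivial wherever the linear part vanishes.\<close>

lemma factors_through_linear_part:
  assumes "A \<in> transvection_span" shows "q A = matrix_image (coeff_mat 1 A)"
  using assms
  by induction (simp_all add: q_one coeff_mat_1_one matrix_image_0 q_mult
    cong_transvection_in_span q_cong_transvection
      matrix_image_add coeff_mat_1_span_mult del: One_nat_def)

end

section \<open>Image and kernel of the linear part\<close>

text \<open>Off-diagonal entries are divisible by \<open>t\<close> and enter the determinant at
  least in pairs, so the coefficient of \<open>t\<close> in \<open>det A = 1\<close> is the trace of
  the linear part.\<close>

lemma trace_coeff_mat_1:
  assumes "A \<in> carrier K3" shows "trace (coeff_mat 1 A) = 0"
proof -
  have "poly.coeff (A $ i $ j) 0 = (if i = j then 1 else 0)" for i j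
    using assms by (simp add: carrier_principal_congruence_group coeff_mat_def mat_def vec_eq_iff)
  moreover have "poly.coeff (det A) 1 = 0"
    using assms by (simp add: carrier_principal_congruence_group)
  ultimately show ?thesis
    by (simp add: det_3 trace_def sum_3 coeff_mat_def coeff_mult_1 coeff_mult_0 ac_simps)
qed

lemma linear_part_onto:
  assumes "trace M = (0 :: bit)" shows "M \<in> coeff_mat 1 ` transvection_span"
proof -
  define L where "L = coeff_mat 1 ` transvection_span"
  have add: "N + N' \<in> L" if "N \<in> L" "N' \<in> L" for N N'
    using that unfolding L_def
    by (auto simp flip: coeff_mat_1_span_mult simp: transvection_span_mult simp del: One_nat_def)
  have outer: "outer u v \<in> L" if "dot u v = 0" for u v :: "bit ^ 3"
    unfolding L_def by (rule image_eqI[OF _ cong_transvection_in_span[OF that, of 1]])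
      (simp add: coeff_mat_cong_transvection del: One_nat_def)
  \<comment> \<open>The last two summands produce the diagonal, with \<open>M $ 2 $ 2\<close> fixed
    by the trace condition. The first three supply the off-diagonal entries, corrected for what the
    last two add there.\<close>
  have "M = outer (vector [1, 0, 0]) (vector [0, M $ 1 $ 2 + M $ 1 $ 1, M $ 1 $ 3])
   + outer (vector [0, 1, 0]) (vector [M $ 2 $ 1 + M $ 1 $ 1, 0, M $ 2 $ 3 + M $ 3 $ 3])
   + outer (vector [0, 0, 1]) (vector [M $ 3 $ 1, M $ 3 $ 2 + M $ 3 $ 3, 0])
   + outer (vector [1, 1, 0]) (vector [M $ 1 $ 1, M $ 1 $ 1, 0])
   + outer (vector [0, 1, 1]) (vector [0, M $ 3 $ 3, M $ 3 $ 3])" (is "_ = ?M")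
  proof -
    have "M $ 2 $ 2 = M $ 1 $ 1 + M $ 3 $ 3"
      using assms by (cases "M $ 1 $ 1"; cases "M $ 2 $ 2"; cases "M $ 3 $ 3")
        (simp_all add: trace_def sum_3)
    then show ?thesis by (simp add: vec_eq_iff forall_3 outer_def add.assoc)
  qed
  also have "?M \<in> L" by (intro add outer) (simp_all add: dot_vector3)
  finally show ?thesis unfolding L_def .
qed

lemma comm_group_sl_additive_group: "comm_group sl_additive_group"
proof (rule comm_groupI)
  fix M :: "'a::comm_ring_1 ^ 'n ^ 'n" assume "M \<in> carrier sl_additive_group"
  then show "\<exists>N\<in>carrier sl_additive_group. N \<otimes>\<^bsub>sl_additive_group\<^esub> M = \<one>\<^bsub>sl_additive_group\<^esub>"
    by (intro bexI[of _ "- M"]) (simp_all add: sl_additive_group_def trace_def sum_negf)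
qed (simp_all add: sl_additive_group_def trace_add trace_0[unfolded mat_0] add_ac)

theorem theorem10p1:
  shows "abelianization (principal_congruence_group :: (bit poly ^ 3 ^ 3) monoid)
           \<cong> (sl_additive_group :: (bit ^ 3 ^ 3) monoid)"
proof -
  interpret K: group K3 by (rule group_K3)
  interpret sl: comm_group sl3 by (rule comm_group_sl_additive_group)
  have lin: "coeff_mat 1 ` carrier K3 = carrier sl3"
    using trace_coeff_mat_1 linear_part_onto
    by (auto simp: sl_additive_group_def carrier_K3_eq_span simp del: One_nat_def)
  interpret lin: group_hom K3 sl3 "coeff_mat 1"
    by unfold_locales
      (use lin in \<open>auto simp: hom_def sl_additive_group_def carrier_K3_eq_span
        coeff_mat_1_span_mult simp del: One_nat_def\<close>)
  let ?D = "derived K3 (carrier K3)"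
  interpret D: normal ?D K3 by (rule K.derived_self_is_normal)
  interpret Q: comm_group "K3 Mod ?D" by (rule K.derived_quot_is_comm_group)
  \<comment> \<open>The factorization is applied to the quotient map onto the
    abelianization.\<close>
  interpret Q: abelian_image "K3 Mod ?D" "\<lambda>A. ?D #>\<^bsub>K3\<^esub> A"
    by unfold_locales (rule D.r_coset_hom_Mod)
  \<comment> \<open>The target is abelian, so the derived subgroup lies in the kernel. Conversely,
    if the linear part of \<open>A\<close> is zero, its coset is \<open>matrix_image 0\<close>, the
    trivial coset.\<close>
  have "kernel K3 sl3 (coeff_mat 1) = ?D"
  proof
    show "?D \<subseteq> kernel K3 sl3 (coeff_mat 1)"
      using lin.derived_img[of "carrier K3"] sl.derived_eq_singleton[of "carrier sl3"] lin D.subset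
      by (auto simp: kernel_def)
    show "kernel K3 sl3 (coeff_mat 1) \<subseteq> ?D"
    proof
      fix A assume "A \<in> kernel K3 sl3 (coeff_mat 1)"
      then have A: "A \<in> carrier K3" "coeff_mat 1 A = 0"
        by (simp_all add: kernel_def sl_additive_group_def)
      then have "?D #>\<^bsub>K3\<^esub> A = ?D"
        using Q.factors_through_linear_part[of A] Q.matrix_image_0
        by (simp add: carrier_K3_eq_span FactGroup_def del: One_nat_def)
      then show "A \<in> ?D" using K.coset_join1 D.subgroup_axioms D.subset A(1) by blast
    qed
  qed
  then show ?thesis
    using lin.FactGroup_iso[OF lin] by (simp add: abelianization_def)
qed

end
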